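(* Let $k\ge 2$ be an integer. (1) If $G$ is a finite cyclic group, then there is a $k$-universal set $U\subset G$ of size at most $72\,|G|^{1-1/k}$. (2) If $G=S_n$ is a symmetric group ($n\ge 1$), then there is a $k$-universal set $U\subset G$ of size at most $(3k+1)!\,|G|^{1-1/k}$. (3) If $G$ is a finite Abelian group, then there is a $k$-universal set $U\subset G$ of size at most $8^{k-1}k\,|G|^{1-1/k}$.
   Context: For a finite group $G$, a set $U\subset G$ is $k$-universal if for every $k$-element subset $W=\{w_1,\dots,w_k\}$ of $G$ (with $|W|=k$) there is $g\in G$ such that $gW=\{gw_1,\dots,gw_k\}\subset U$. *)

theory Defs
  imports Complex_Main "HOL-Algebra.Elementary_Groups" "HOL-Algebra.Sym_Groups"
begin

definition universal_set :: "('a, 'b) monoid_scheme \<Rightarrow> nat \<Rightarrow> 'a set \<Rightarrow> bool"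
  where "universal_set G k U \<longleftrightarrow>
    U \<subseteq> carrier G \<and>
    (\<forall>W. W \<subseteq> carrier G \<and> finite W \<and> card W = k \<longrightarrow>
      (\<exists>g \<in> carrier G. g <#\<^bsub>G\<^esub> W \<subseteq> U))"

end

theory Submission
  imports Defs "HOL-Algebra.Sylow" "HOL-Algebra.Algebraic_Closure_Type" "HOL-Library.Z2"
begin

text \<open>
  A universal set of nearly optimal size is obtained in each of the three families from a way of
  making \<open>k\<close> choices that all succeed at once, each of which has probability about
  \<open>|G| ^ (-1 / k)\<close>.

  In a cyclic group this is linear algebra over a finite field \<open>F\<close>. The unit group of \<open>F\<close> is cyclic, and the
  nonzero elements of an additive subgroup \<open>H\<close> of index \<open>q\<close> form a universal set in it as soon as
  \<open>q ^ k < |F|\<close>: by the pigeonhole principle (\<open>ex_common_multiplier\<close>) any \<open>k\<close> elements can be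
  multiplied into \<open>H\<close> by a common nonzero factor. With \<open>|F| = 2 * q ^ k\<close> and \<open>q\<close> a power of two the
  density of \<open>H\<close> is within an absolute constant of the ideal one; a general
  cyclic group is reduced to this case by using such a set periodically. No factor
  \<open>k\<close> is lost, because a single subgroup serves all \<open>k\<close> elements.

  In the symmetric group, positions of records (left-to-right maxima) play the role of digits:
  being a record at position \<open>v\<close> has probability \<open>1 / v\<close>, independently for different positions
  (\<open>card_permutations_with_records_le\<close>), and a word can be written letter by letter so
  that every position becomes a record in the order induced by any one of the \<open>k\<close> given
  permutations, chosen freely for each position (\<open>ex_bij_with_prescribed_records\<close>). What remains is to distribute
  the numbers \<open>1, \<dots>, n\<close> over \<open>k\<close> classes with nearly equal products
  (\<open>ex_balanced_colouring\<close>).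

  In an abelian group the translation is approximated in \<open>k\<close> steps, each of which confines it
  to a set smaller by the factor \<open>|G| ^ (1 / k)\<close> and takes care of one of the \<open>k\<close> elements. The confining sets are
  blocks of consecutive cosets of a subgroup: they exist in all sizes, up to a factor of two,
  and behave like intervals (\<open>ex_refined_progression\<close>). This gives the constant \<open>8 * k\<close>, which is
  at most \<open>8 ^ (k - 1) * k\<close> for \<open>k \<ge> 2\<close>.
\<close>

text \<open>
  The unqualified names refer to the order of a group and the unit group of a field.
\<close>

hide_const (open) Polynomial.order Ring_Divisibility.mult_of

section \<open>Finite fields of characteristic two\<close>

text \<open>
  Over an algebraically closed field a polynomial splits into linear factors, and a factor that
  occurred twice would make its root a root of the derivative as well.
\<close>

lemma card_roots_separable:
  fixes p :: "'a :: alg_closed_field poly"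
  assumes sep: "\<And>x. poly p x = 0 \<Longrightarrow> poly (pderiv p) x \<noteq> 0" and "p \<noteq> 0"
  shows "card {x. poly p x = 0} = degree p"
proof -
  obtain A where A: "size A = degree p" "p = smult (lead_coeff p) (\<Prod>x\<in>#A. [:-x, 1:])"
    using alg_closed_imp_factorization[OF \<open>p \<noteq> 0\<close>] by blast
  have roots: "{x. poly p x = 0} = set_mset A"
    using \<open>p \<noteq> 0\<close> by (subst A(2)) (auto simp: poly_prod_mset prod_mset_zero_iff)
  have "count A x = 1" if "x \<in># A" for x
  proof (rule ccontr)
    assume "count A x \<noteq> 1"
    moreover have "count A x > 0" using that by simp
    ultimately have "count A x > 1" by linarith
    then have "x \<in># A - {#x#}" by (simp add: in_diff_count)
    then obtain B where "A - {#x#} = add_mset x B" by (blast dest: multi_member_split)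
    then have B: "A = add_mset x (add_mset x B)" using that insert_DiffM[of x A] by simp
    obtain c where c: "p = smult c (\<Prod>x\<in>#A. [:-x, 1:])" using A(2) by blast
    define r where "r = smult c (\<Prod>x\<in>#B. [:-x, 1:])"
    have r: "p = [:-x, 1:] * ([:-x, 1:] * r)"
      unfolding c B r_def by (simp only: image_mset_add_mset prod_mset.add_mset mult_smult_right)
    have "poly p x = 0" by (subst r) simp
    moreover have "poly (pderiv p) x = 0"
      by (subst r) (simp only: pderiv_mult poly_add poly_mult, simp)
    ultimately show False using sep by blast
  qed
  then have "size A = card (set_mset A)"
    by (simp add: size_multiset_overloaded_eq)
  then show ?thesis using roots A(1) by simp
qed

text \<open>
  The field with \<open>2 ^ d\<close> elements, realised as the fixed points of the \<open>d\<close>-th power of the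
  Frobenius map on the algebraic closure of the field with two elements. For \<open>d = 0\<close> the
  definition gives the whole closure.
\<close>

definition gf :: "nat \<Rightarrow> bit alg_closure ring"
  where "gf d = ring_of_type_algebra\<lparr>carrier := {x. x ^ (2 ^ d) = x}\<rparr>"

lemma alg_closure_bit_double: "(x :: bit alg_closure) + x = 0"
proof -
  have "(1 :: bit alg_closure) + 1 = to_ac (1 + 1)" by (simp only: to_ac_add to_ac_1)
  also have "(1 + 1 :: bit) = 0" by simp
  finally have "(1 :: bit alg_closure) + 1 = 0" by (simp only: to_ac_0)
  then show ?thesis by (metis distrib_left mult_1_right mult_zero_right)
qed

lemma frobenius_add: "(x + y :: bit alg_closure) ^ (2 ^ d) = x ^ (2 ^ d) + y ^ (2 ^ d)"
proof (induction d)
  case (Suc d)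
  have sq: "(u + v) ^ 2 = u ^ 2 + v ^ 2" for u v :: "bit alg_closure"
    using alg_closure_bit_double[of "u * v"] by (simp add: power2_sum mult_2 algebra_simps)
  show ?case by (simp only: power_Suc2 power_mult Suc sq)
qed simp

text \<open>
  The polynomial \<open>X ^ (2 ^ d) - X\<close> has derivative \<open>-1\<close> in characteristic two, hence only simple
  roots.
\<close>

lemma card_gf:
  assumes "d \<ge> 1"
  shows "card (carrier (gf d)) = 2 ^ d"
proof -
  define p :: "bit alg_closure poly" where "p = monom 1 (2 ^ d) - monom 1 1"
  have q: "(2::nat) ^ d > 1" using assms one_less_power[of "2::nat" d] by simp
  have deg: "degree p = 2 ^ d"
  proof (rule antisym)
    show "degree p \<le> 2 ^ d"
      unfolding p_def using q by (intro degree_diff_le) (auto simp: degree_monom_eq)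
    show "2 ^ d \<le> degree p"
      using q by (intro le_degree) (auto simp: p_def)
  qed
  have "even ((2::nat) ^ d)" using assms by simp
  then obtain c where c: "(2::nat) ^ d = c + c" by (metis evenE mult_2)
  have "of_nat (2 ^ d) = (0 :: bit alg_closure)"
    unfolding c of_nat_add by (rule alg_closure_bit_double)
  then have "pderiv p = - 1"
    by (simp add: p_def pderiv_diff pderiv_monom del: of_nat_power of_nat_numeral)
  then have "card {x. poly p x = 0} = degree p"
    using deg q by (intro card_roots_separable) auto
  also have "{x. poly p x = 0} = carrier (gf d)"
    by (simp add: p_def gf_def poly_monom)
  finally show ?thesis using deg by simp
qed

lemma field_gf: "field (gf d)"
proof -
  interpret F: field "ring_of_type_algebra :: bit alg_closure ring"
    by (rule field_from_type_algebra)
  let ?K = "{x :: bit alg_closure. x ^ (2 ^ d) = x}"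
  have neg: "- x = x" for x :: "bit alg_closure"
    using alg_closure_bit_double[of x] by (rule minus_unique)
  have a_inv: "\<ominus>\<^bsub>ring_of_type_algebra\<^esub> x = - x" for x :: "bit alg_closure"
    by (rule F.minus_equality) (auto simp: ring_of_type_algebra_def)
  have m_inv: "inv\<^bsub>ring_of_type_algebra\<^esub> x = inverse x" if "x \<noteq> 0" for x :: "bit alg_closure"
    by (rule F.comm_inv_char) (use that in \<open>auto simp: ring_of_type_algebra_def\<close>)
  have "subring ?K (ring_of_type_algebra :: bit alg_closure ring)"
    by (rule F.subringI)
      (auto simp: a_inv frobenius_add power_mult_distrib neg, 
       auto simp: ring_of_type_algebra_def frobenius_add power_mult_distrib neg)
  then have "subfield ?K (ring_of_type_algebra :: bit alg_closure ring)"
  proof (rule F.subfieldI')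
    fix k assume k: "k \<in> ?K - {\<zero>\<^bsub>ring_of_type_algebra\<^esub>}"
    then have "k \<noteq> 0" by (simp add: ring_of_type_algebra_def)
    moreover have "inverse k ^ (2 ^ d) = inverse k" using k by (simp add: power_inverse)
    ultimately show "inv\<^bsub>ring_of_type_algebra\<^esub> k \<in> ?K" by (simp add: m_inv)
  qed
  then show ?thesis
    unfolding gf_def by (rule F.subfield_iff)
qed

section \<open>Cyclic groups\<close>

text \<open>
  Pigeonhole: if \<open>q\<close> is the index of \<open>H\<close>, the products of \<open>y\<close> with the elements of \<open>W\<close> fall into at
  most \<open>q ^ card W\<close> patterns of cosets of \<open>H\<close>. Two distinct \<open>y\<close> with the same pattern exist, and
  their difference multiplies all of \<open>W\<close> into \<open>H\<close>.
\<close>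

lemma (in field) ex_common_multiplier:
  assumes fin: "finite (carrier R)" and H: "subgroup H (add_monoid R)"
    and "finite W" "W \<subseteq> carrier R"
    and many: "card (rcosets\<^bsub>add_monoid R\<^esub> H) ^ card W < order R"
  shows "\<exists>y \<in> carrier R - {\<zero>}. \<forall>w\<in>W. y \<otimes> w \<in> H"
proof -
  let ?C = "rcosets\<^bsub>add_monoid R\<^esub> H"
  have HR: "H \<subseteq> carrier R" using subgroup.subset[OF H] by simp
  define f where "f y = (\<lambda>w\<in>W. H #>\<^bsub>add_monoid R\<^esub> (y \<otimes> w))" for y
  have "finite ?C"
    using fin add.rcosets_part_G[OF H] by (intro finite_UnionD) simp
  then have "finite (W \<rightarrow>\<^sub>E ?C)" using \<open>finite W\<close> by (simp add: finite_PiE)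
  moreover have "f ` carrier R \<subseteq> W \<rightarrow>\<^sub>E ?C"
  proof (intro image_subsetI PiE_I)
    fix x w assume "x \<in> carrier R" "w \<in> W"
    then have "x \<otimes> w \<in> carrier R" using \<open>W \<subseteq> carrier R\<close> by (intro m_closed) auto
    then show "f x w \<in> ?C" using HR \<open>w \<in> W\<close> add.rcosetsI[of H] by (simp add: f_def)
  qed (simp add: f_def)
  ultimately have "card (f ` carrier R) \<le> card (W \<rightarrow>\<^sub>E ?C)" by (rule card_mono)
  also have "\<dots> < card (carrier R)"
    using many \<open>finite W\<close> by (simp add: card_PiE Coset.order_def)
  finally have "\<not> inj_on f (carrier R)" by (metis card_image less_irrefl)
  then obtain x y where xy: "x \<in> carrier R" "y \<in> carrier R" "x \<noteq> y" "f x = f y"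
    by (auto simp: inj_on_def)
  show ?thesis
  proof (intro bexI ballI)
    show "x \<ominus> y \<in> carrier R - {\<zero>}" using xy by simp
  next
    fix w assume w: "w \<in> W"
    then have "w \<in> carrier R" using \<open>W \<subseteq> carrier R\<close> by auto
    have "H #>\<^bsub>add_monoid R\<^esub> (x \<otimes> w) = H #>\<^bsub>add_monoid R\<^esub> (y \<otimes> w)"
      using fun_cong[OF xy(4), of w] w by (simp add: f_def)
    moreover have "x \<otimes> w \<in> H #>\<^bsub>add_monoid R\<^esub> (x \<otimes> w)"
      using add.rcos_self[OF _ H] xy \<open>w \<in> carrier R\<close> by simp
    ultimately obtain h where h: "h \<in> H" "x \<otimes> w = h \<oplus> y \<otimes> w"
      by (auto simp: r_coset_def)
    then have "h \<in> carrier R" using HR by auto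
    have "(x \<ominus> y) \<otimes> w = x \<otimes> w \<ominus> y \<otimes> w"
      using xy \<open>w \<in> carrier R\<close> by algebra
    also have "\<dots> = h"
      unfolding h(2) using xy \<open>w \<in> carrier R\<close> \<open>h \<in> carrier R\<close> by algebra
    finally show "(x \<ominus> y) \<otimes> w \<in> H" using h by simp
  qed
qed

text \<open>
  A universal set for the additive group of residues modulo \<open>M\<close>. The field with \<open>M + 1\<close>
  elements has a cyclic unit group, with generator \<open>\<alpha>\<close> say, and \<open>S\<close> consists of the discrete
  logarithms of the nonzero elements of an additive subgroup of index \<open>2 ^ e\<close>. Translating
  exponents by \<open>g\<close> amounts to multiplying field elements by \<open>\<alpha> ^ g\<close>, so a common multiplier is exactly
  a translation into \<open>S\<close>. The number \<open>2 ^ (e * k + 1)\<close> of field elements is the smallest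
  power of two for which the pigeonhole argument works.
\<close>

lemma ex_universal_residues:
  fixes e k :: nat
  assumes "k \<ge> 1"
  defines "M \<equiv> 2 ^ (e * k + 1) - 1"
  shows "\<exists>S. S \<subseteq> {..<M} \<and> card S * 2 ^ e \<le> M \<and>
    (\<forall>A. finite A \<and> card A \<le> k \<longrightarrow> (\<exists>g<M. \<forall>a\<in>A. (g + a) mod M \<in> S))"
proof -
  define d where "d = e * k + 1"
  interpret F: field "gf d" by (rule field_gf)
  let ?F = "gf d" and ?A = "add_monoid (gf d)"
  have cF: "card (carrier ?F) = 2 ^ d" by (rule card_gf) (simp add: d_def)
  then have fin: "finite (carrier ?F)" by (metis card.infinite power_not_zero zero_neq_numeral)
  have "e \<le> d" using \<open>k \<ge> 1\<close> unfolding d_def by (metis Suc_eq_plus1 le_SucI mult.right_neutral mult_le_mono2)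
  then have "order ?A = 2 ^ (d - e) * 2 ^ e"
    by (simp add: Coset.order_def cF flip: power_add)
  then obtain H where H: "subgroup H ?A" "card H = 2 ^ (d - e)"
    using sylow_thm[of 2 ?A "d - e" "2 ^ e"] F.add.is_group fin by auto
  have "card (rcosets\<^bsub>?A\<^esub> H) * 2 ^ (d - e) = 2 ^ e * 2 ^ (d - e)"
    using F.add.lagrange[OF H(1)] H(2) \<open>order ?A = _\<close> by simp
  then have index: "card (rcosets\<^bsub>?A\<^esub> H) = 2 ^ e" by simp
  have HF: "H \<subseteq> carrier ?F" using subgroup.subset[OF H(1)] by simp
  have zH: "\<zero>\<^bsub>?F\<^esub> \<in> H" using subgroup.one_closed[OF H(1)] by simp
  obtain \<alpha> where \<alpha>: "\<alpha> \<in> carrier (mult_of ?F)"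
    and gen: "carrier (mult_of ?F) = {\<alpha> [^]\<^bsub>?F\<^esub> i | i::nat. i \<in> UNIV}"
    by (rule bexE[OF F.finite_field_mult_group_has_gen[OF fin]])
  interpret M: group "mult_of ?F" by (rule F.field_mult_group)
  have pow: "x [^]\<^bsub>mult_of ?F\<^esub> (i::nat) = x [^]\<^bsub>?F\<^esub> i" for x i
    by (simp add: Multiplicative_Group.nat_pow_mult_of)
  have M: "card (carrier (mult_of ?F)) = M"
    using cF F.zero_closed fin by (simp add: M_def Multiplicative_Group.carrier_mult_of card_Diff_singleton d_def)
  have "M > 0" unfolding M_def using one_less_power[of "2::nat" "e * k + 1"] by simp
  have mod: "\<alpha> [^]\<^bsub>?F\<^esub> (i mod M) = \<alpha> [^]\<^bsub>?F\<^esub> i" for i :: nat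
  proof -
    have "\<alpha> [^]\<^bsub>mult_of ?F\<^esub> M = \<one>\<^bsub>mult_of ?F\<^esub>"
      using M.pow_order_eq_1[OF \<alpha>] M by (simp add: Coset.order_def)
    then have "\<alpha> [^]\<^bsub>mult_of ?F\<^esub> (M * (i div M)) = \<one>\<^bsub>mult_of ?F\<^esub>"
      by (metis M.nat_pow_one M.nat_pow_pow \<alpha>)
    then have "\<alpha> [^]\<^bsub>mult_of ?F\<^esub> (M * (i div M) + i mod M) = \<alpha> [^]\<^bsub>mult_of ?F\<^esub> (i mod M)"
      using \<alpha> by (metis M.l_one M.nat_pow_closed M.nat_pow_mult)
    then show ?thesis by (simp add: pow)
  qed
  have surj: "carrier (mult_of ?F) = (\<lambda>i. \<alpha> [^]\<^bsub>?F\<^esub> i) ` {..<M}"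
  proof
    show "carrier (mult_of ?F) \<subseteq> (\<lambda>i. \<alpha> [^]\<^bsub>?F\<^esub> i) ` {..<M}"
    proof
      fix x assume "x \<in> carrier (mult_of ?F)"
      then obtain i :: nat where "x = \<alpha> [^]\<^bsub>?F\<^esub> i" using gen by blast
      then have "x = \<alpha> [^]\<^bsub>?F\<^esub> (i mod M)" by (simp add: mod)
      then show "x \<in> (\<lambda>i. \<alpha> [^]\<^bsub>?F\<^esub> i) ` {..<M}" using \<open>M > 0\<close> by auto
    qed
  qed (use gen in blast)
  then have inj: "inj_on (\<lambda>i. \<alpha> [^]\<^bsub>?F\<^esub> i) {..<M}"
    using M by (intro eq_card_imp_inj_on) auto
  define S where "S = {i. i < M \<and> \<alpha> [^]\<^bsub>?F\<^esub> i \<in> H}"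
  have "card S = card ((\<lambda>i. \<alpha> [^]\<^bsub>?F\<^esub> i) ` S)"
    by (rule card_image[symmetric], rule inj_on_subset[OF inj]) (auto simp: S_def)
  also have "\<dots> \<le> card (H - {\<zero>\<^bsub>?F\<^esub>})"
    using surj fin HF by (intro card_mono) (auto simp: S_def Multiplicative_Group.carrier_mult_of finite_subset)
  also have "\<dots> = 2 ^ (d - e) - 1"
    using zH H(2) by simp
  finally have "card S * 2 ^ e \<le> (2 ^ (d - e) - 1) * 2 ^ e" by simp
  also have "\<dots> = 2 ^ d - 2 ^ e"
    using \<open>e \<le> d\<close> by (simp add: diff_mult_distrib flip: power_add)
  also have "\<dots> \<le> M" by (simp add: M_def d_def diff_le_mono2)
  finally have card_S: "card S * 2 ^ e \<le> M" .
  have "\<exists>g<M. \<forall>a\<in>A. (g + a) mod M \<in> S" if A: "finite A" "card A \<le> k" for A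
  proof -
    let ?W = "(\<lambda>a. \<alpha> [^]\<^bsub>?F\<^esub> (a::nat)) ` A"
    have "card ?W \<le> k" using A card_image_le order_trans by blast
    then have "(2 ^ e) ^ card ?W \<le> (2::nat) ^ (e * k)"
      by (simp add: power_increasing flip: power_mult)
    also have "\<dots> < order ?F" unfolding Coset.order_def cF by (simp add: d_def)
    finally have few: "card (rcosets\<^bsub>?A\<^esub> H) ^ card ?W < order ?F" by (simp only: index)
    have "\<alpha> \<in> carrier ?F" using \<alpha> by simp
    then have "?W \<subseteq> carrier ?F" by (intro image_subsetI F.nat_pow_closed)
    then obtain y where y: "y \<in> carrier ?F - {\<zero>\<^bsub>?F\<^esub>}" "\<forall>w\<in>?W. y \<otimes>\<^bsub>?F\<^esub> w \<in> H"
      by (rule bexE[OF F.ex_common_multiplier[OF fin H(1) finite_imageI[OF A(1)] _ few]])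
    then obtain g where g: "g < M" "y = \<alpha> [^]\<^bsub>?F\<^esub> g" using surj by (metis Multiplicative_Group.carrier_mult_of imageE lessThan_iff)
    have "(g + a) mod M \<in> S" if "a \<in> A" for a
    proof -
      have "\<alpha> [^]\<^bsub>?F\<^esub> (g + a) = y \<otimes>\<^bsub>?F\<^esub> \<alpha> [^]\<^bsub>?F\<^esub> a"
        using g(2) F.nat_pow_mult[OF \<open>\<alpha> \<in> carrier ?F\<close>] by simp
      then show ?thesis using y(2) that \<open>M > 0\<close> by (simp add: S_def mod)
    qed
    then show ?thesis using g by blast
  qed
  then show ?thesis using card_S by (intro exI[of _ S]) (auto simp: S_def)
qed


lemma card_bounded_residues_le:
  fixes M N :: nat
  assumes "finite S"
  shows "card {x. x < N \<and> x mod M \<in> S} \<le> (N div M + 1) * card S"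
proof -
  have "card {x. x < N \<and> x mod M \<in> S} \<le> card ({..N div M} \<times> S)"
  proof (rule card_inj_on_le)
    show "inj_on (\<lambda>x. (x div M, x mod M)) {x. x < N \<and> x mod M \<in> S}"
      by (rule inj_onI) (metis Pair_inject div_mult_mod_eq)
  qed (use assms in \<open>auto intro: div_le_mono\<close>)
  then show ?thesis by (simp add: card_cartesian_product)
qed

text \<open>
  The modulus of the universal set of residues need not divide the order \<open>N\<close> of the group, so the set is
  used periodically: elements of the group are written as powers of a generator with exponents
  below \<open>N\<close>, and all exponents below \<open>N + M\<close> whose residue modulo \<open>M\<close> lies in \<open>S\<close> are
  admitted. With \<open>q\<close> the largest power of two such that \<open>q ^ k \<le> N\<close>, the modulus is less than
  \<open>2 * N\<close>, so the number of these exponents is at most \<open>5 * N / q\<close>.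
\<close>

lemma cyclic_universal_set:
  fixes G :: "('a, 'm) monoid_scheme"
  assumes "group G" and fin: "finite (carrier G)" and "cyclic_group G" and "k \<ge> 1"
  shows "\<exists>U. universal_set G k U \<and> real (card U) \<le> 10 * real (order G) powr (1 - 1 / real k)"
proof -
  interpret group G by fact
  define N where "N = order G"
  have "N > 0" unfolding N_def using fin order_gt_0_iff_finite by blast
  obtain a where a: "a \<in> carrier G" and gen: "carrier G = range (\<lambda>n::int. a [^]\<^bsub>G\<^esub> n)"
    using \<open>cyclic_group G\<close> cyclic_group by blast
  have index: "\<exists>n::nat. a [^]\<^bsub>G\<^esub> n = w \<and> n < N" if w: "w \<in> carrier G" for w
  proof -
    obtain n :: int where n: "w = a [^]\<^bsub>G\<^esub> n" using gen w by blast
    have "a [^]\<^bsub>G\<^esub> (int N * (n div int N)) = \<one>\<^bsub>G\<^esub>"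
      using pow_order_eq_1[OF a] a by (simp add: N_def int_pow_int flip: int_pow_pow)
    then have "a [^]\<^bsub>G\<^esub> (int N * (n div int N) + n mod int N) = a [^]\<^bsub>G\<^esub> (n mod int N)"
      using a by (simp only: int_pow_mult int_pow_closed l_one)
    also have "\<dots> = a [^]\<^bsub>G\<^esub> int (nat (n mod int N))" using \<open>N > 0\<close> by simp
    finally have "a [^]\<^bsub>G\<^esub> nat (n mod int N) = w"
      using n by (simp only: int_pow_int mult_div_mod_eq)
    moreover have "nat (n mod int N) < N" using \<open>N > 0\<close> by (simp add: nat_less_iff)
    ultimately show ?thesis by blast
  qed
  have "(2::nat) ^ k \<ge> 2" using \<open>k \<ge> 1\<close> by (metis one_le_numeral power_increasing power_one_right)
  then obtain e where e: "(2 ^ k) ^ e \<le> N" "N < (2 ^ k) ^ (e + 1)"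
    using ex_power_ivl1[of "2 ^ k" N] \<open>N > 0\<close> by auto
  define q :: nat where "q = 2 ^ e"
  have q: "q ^ k \<le> N" "N < (2 * q) ^ k" "q > 0"
    using e by (simp_all add: q_def power_mult_distrib mult.commute flip: power_mult)
  define M :: nat where "M = 2 ^ (e * k + 1) - 1"
  have M: "M = 2 * q ^ k - 1" by (simp add: M_def q_def power_mult)
  have "M > 0" using zero_less_power[OF q(3), of k] unfolding M by linarith
  obtain S where S: "S \<subseteq> {..<M}" "card S * q \<le> M"
    "\<And>A. finite A \<Longrightarrow> card A \<le> k \<Longrightarrow> \<exists>g<M. \<forall>a\<in>A. (g + a) mod M \<in> S"
    using ex_universal_residues[OF \<open>k \<ge> 1\<close>, of e] unfolding M_def q_def by blast
  define U where "U = (\<lambda>x::nat. a [^]\<^bsub>G\<^esub> x) ` {x. x < N + M \<and> x mod M \<in> S}"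
  have "universal_set G k U"
    unfolding universal_set_def
  proof (intro conjI allI impI)
    show "U \<subseteq> carrier G" using a by (auto simp: U_def)
    fix W assume W: "W \<subseteq> carrier G \<and> finite W \<and> card W = k"
    obtain f where f: "\<And>w. w \<in> W \<Longrightarrow> a [^]\<^bsub>G\<^esub> (f w :: nat) = w \<and> f w < N"
      using index W by (metis subsetD)
    obtain g where g: "g < M" "\<And>w. w \<in> W \<Longrightarrow> (g + f w) mod M \<in> S"
      using S(3)[of "f ` W"] W card_image_le[of W f] by auto
    have "a [^]\<^bsub>G\<^esub> g \<otimes>\<^bsub>G\<^esub> w \<in> U" if "w \<in> W" for w
    proof -
      have "a [^]\<^bsub>G\<^esub> g \<otimes>\<^bsub>G\<^esub> w = a [^]\<^bsub>G\<^esub> (g + f w)"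
        using f[OF that] a nat_pow_mult[of a g "f w"] by simp
      moreover have "g + f w < N + M" using g f[OF that] by simp
      ultimately show ?thesis using g(2)[OF that] unfolding U_def by blast
    qed
    then show "\<exists>g\<in>carrier G. g <#\<^bsub>G\<^esub> W \<subseteq> U"
      using a by (intro bexI[of _ "a [^]\<^bsub>G\<^esub> g"]) (auto simp: l_coset_def)
  qed
  moreover have "real (card U) \<le> 10 * real N powr (1 - 1 / real k)"
  proof -
    have "finite S" using S(1) finite_subset by blast
    have "card U \<le> card {x. x < N + M \<and> x mod M \<in> S}"
      unfolding U_def by (rule card_image_le) simp
    also have "\<dots> \<le> ((N + M) div M + 1) * card S"
      by (rule card_bounded_residues_le) fact
    finally have "card U * q \<le> ((N + M) div M + 1) * card S * q" by (rule mult_le_mono1)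
    also have "\<dots> = ((N + M) div M + 1) * (card S * q)" by (rule mult.assoc)
    also have "\<dots> \<le> ((N + M) div M + 1) * M" using S(2) by (rule mult_le_mono2)
    also have "\<dots> \<le> N + 2 * M"
      using div_times_less_eq_dividend[of "N + M" M] by (simp only: add_mult_distrib)
    also have "\<dots> \<le> 5 * N" using q(1) unfolding M by linarith
    finally have le: "real (card U) * real q \<le> 5 * real N" by (metis of_nat_le_iff of_nat_mult of_nat_numeral)
    have "real N powr (1 / real k) \<le> (real (2 * q) ^ k) powr (1 / real k)"
    proof (rule powr_mono2)
      show "real N \<le> real (2 * q) ^ k"
        using q(2) unfolding of_nat_power[symmetric] of_nat_le_iff by (rule less_imp_le)
    qed simp_all
    also have "real (2 * q) ^ k = real (2 * q) powr real k"
      using q(3) by (intro powr_realpow[symmetric]) simp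
    also have "\<dots> powr (1 / real k) = 2 * real q"
      unfolding powr_powr using q(3) \<open>k \<ge> 1\<close> by simp
    finally have root: "real N powr (1 / real k) \<le> 2 * real q" .
    have "real (card U) * real N powr (1 / real k) \<le> real (card U) * (2 * real q)"
      using root by (intro mult_left_mono) auto
    also have "\<dots> \<le> 10 * real N" using le by linarith
    finally show ?thesis using \<open>N > 0\<close> by (simp add: powr_diff field_simps)
  qed
  ultimately show ?thesis unfolding N_def by blast
qed

section \<open>Symmetric groups\<close>

text \<open>
  Position \<open>v\<close> of the word \<open>\<sigma> 1, \<sigma> 2, \<dots>\<close> is a left-to-right maximum (a record).
\<close>

definition record_at :: "(nat \<Rightarrow> nat) \<Rightarrow> nat \<Rightarrow> bool"
  where "record_at \<sigma> v \<longleftrightarrow> (\<forall>u\<in>{1..v}. \<sigma> u \<le> \<sigma> v)"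

text \<open>
  Extensionality makes these sets finite, so that they can be counted by induction.
\<close>

definition bij_with_records :: "nat set \<Rightarrow> nat \<Rightarrow> nat set \<Rightarrow> (nat \<Rightarrow> nat) set"
  where "bij_with_records V n R = {\<sigma> \<in> extensional {1..n}.
    bij_betw \<sigma> {1..n} R \<and> (\<forall>v\<in>V \<inter> {1..n}. record_at \<sigma> v)}"

text \<open>
  Records at different positions behave like independent events, position \<open>v\<close> being a record with
  probability \<open>1 / v\<close>. In the induction the last letter of the word is chosen first: it is forced
  to be the maximum if a record is required there, and is arbitrary otherwise.
\<close>

lemma card_bij_with_records_le:
  assumes "finite R" "card R = n"
  shows "finite (bij_with_records V n R) \<and>
    card (bij_with_records V n R) * \<Prod>(V \<inter> {1..n}) \<le> fact n"
  using assms
proof (induction n arbitrary: R)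
  case 0
  then have "bij_with_records V 0 R \<subseteq> {\<lambda>_. undefined}"
    by (auto simp: bij_with_records_def)
  then show ?case
    using card_mono[of "{\<lambda>_. undefined}" "bij_with_records V 0 R"] by (auto intro: finite_subset)
next
  case (Suc n)
  define E where "E = (if Suc n \<in> V then {Max R} else R)"
  define Q where "Q = \<Prod>(V \<inter> {1..n})"
  have "R \<noteq> {}" using Suc.prems by auto
  have E: "E \<subseteq> R" "finite E"
    using Suc.prems \<open>R \<noteq> {}\<close> by (auto simp: E_def)
  have sub: "bij_with_records V (Suc n) R \<subseteq>
    (\<Union>e\<in>E. (\<lambda>\<sigma>. \<sigma>(Suc n := e)) ` bij_with_records V n (R - {e}))"
  proof
    fix \<sigma> assume \<sigma>: "\<sigma> \<in> bij_with_records V (Suc n) R"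
    then have bij: "bij_betw \<sigma> {1..Suc n} R" and ext: "\<sigma> \<in> extensional {1..Suc n}"
      and rec: "\<And>v. v \<in> V \<Longrightarrow> 1 \<le> v \<Longrightarrow> v \<le> Suc n \<Longrightarrow> record_at \<sigma> v"
      by (auto simp: bij_with_records_def)
    have last: "\<sigma> (Suc n) \<in> E"
    proof (cases "Suc n \<in> V")
      case True
      then have "\<forall>u\<in>{1..Suc n}. \<sigma> u \<le> \<sigma> (Suc n)" using rec[of "Suc n"] by (simp add: record_at_def)
      then have "\<forall>r\<in>R. r \<le> \<sigma> (Suc n)" using bij by (auto simp: bij_betw_def)
      moreover have "\<sigma> (Suc n) \<in> R" using bij by (auto simp: bij_betw_def)
      ultimately have "Max R = \<sigma> (Suc n)" using Suc.prems by (intro Max_eqI) auto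
      then show ?thesis using True by (simp add: E_def)
    next
      case False
      then show ?thesis using bij by (auto simp: E_def bij_betw_def)
    qed
    define \<tau> where "\<tau> = \<sigma>(Suc n := undefined)"
    have "bij_betw \<sigma> {1..n} (R - {\<sigma> (Suc n)})"
    proof -
      have "{1..Suc n} - {Suc n} = {1..n}" by auto
      moreover have "\<sigma> (Suc n) \<in> R" using bij by (auto simp: bij_betw_def)
      ultimately show ?thesis using bij_betw_DiffI[OF bij, of "{Suc n}" "{\<sigma> (Suc n)}"] by simp
    qed
    moreover have "\<tau> u = \<sigma> u" if "u \<in> {1..n}" for u using that by (simp add: \<tau>_def)
    ultimately have "bij_betw \<tau> {1..n} (R - {\<sigma> (Suc n)})" by (metis (no_types, lifting) bij_betw_cong)
    moreover have "record_at \<tau> v" if "v \<in> V" "1 \<le> v" "v \<le> n" for v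
      using rec[of v] that by (auto simp: record_at_def \<tau>_def)
    moreover have "\<tau> \<in> extensional {1..n}"
      using ext by (auto simp: \<tau>_def extensional_def)
    ultimately have "\<tau> \<in> bij_with_records V n (R - {\<sigma> (Suc n)})"
      by (auto simp: bij_with_records_def)
    moreover have "\<sigma> = \<tau>(Suc n := \<sigma> (Suc n))" by (simp add: \<tau>_def)
    ultimately show "\<sigma> \<in> (\<Union>e\<in>E. (\<lambda>\<sigma>. \<sigma>(Suc n := e)) ` bij_with_records V n (R - {e}))"
      using last by blast
  qed
  have IH: "finite (bij_with_records V n (R - {e}))"
    "card (bij_with_records V n (R - {e})) * Q \<le> fact n" if "e \<in> E" for e
    using Suc.IH[of "R - {e}"] Suc.prems that E(1) by (auto simp: Q_def subset_iff)
  have fin: "finite (\<Union>e\<in>E. (\<lambda>\<sigma>. \<sigma>(Suc n := e)) ` bij_with_records V n (R - {e}))"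
    using E IH by auto
  have "card (bij_with_records V (Suc n) R)
      \<le> (\<Sum>e\<in>E. card ((\<lambda>\<sigma>. \<sigma>(Suc n := e)) ` bij_with_records V n (R - {e})))"
    using card_mono[OF fin sub] card_UN_le[OF E(2)] order_trans by blast
  also have "\<dots> \<le> (\<Sum>e\<in>E. card (bij_with_records V n (R - {e})))"
    using IH by (intro sum_mono card_image_le)
  finally have "card (bij_with_records V (Suc n) R) * Q
      \<le> (\<Sum>e\<in>E. card (bij_with_records V n (R - {e}))) * Q" by (rule mult_le_mono1)
  also have "\<dots> = (\<Sum>e\<in>E. card (bij_with_records V n (R - {e})) * Q)"
    by (rule sum_distrib_right)
  also have "\<dots> \<le> (\<Sum>e\<in>E. fact n)" using IH by (intro sum_mono)
  finally have main: "card (bij_with_records V (Suc n) R) * Q \<le> card E * fact n" by simp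
  have prod: "\<Prod>(V \<inter> {1..Suc n}) * card E = Suc n * Q"
  proof (cases "Suc n \<in> V")
    case True
    then have "V \<inter> {1..Suc n} = insert (Suc n) (V \<inter> {1..n})" by auto
    then show ?thesis using True by (simp add: E_def Q_def)
  next
    case False
    then have "V \<inter> {1..Suc n} = V \<inter> {1..n}" using le_Suc_eq by auto
    then show ?thesis using False Suc.prems by (simp add: E_def Q_def)
  qed
  have "card E > 0" using E \<open>R \<noteq> {}\<close> by (auto simp: E_def card_gt_0_iff)
  have "card (bij_with_records V (Suc n) R) * (Suc n * Q) \<le> card E * fact (Suc n)"
    using mult_le_mono2[OF main, of "Suc n"] by (simp add: algebra_simps)
  then have "card (bij_with_records V (Suc n) R) * (\<Prod>(V \<inter> {1..Suc n}) * card E)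
      \<le> card E * fact (Suc n)" unfolding prod .
  then have "card E * (card (bij_with_records V (Suc n) R) * \<Prod>(V \<inter> {1..Suc n}))
      \<le> card E * fact (Suc n)" by (simp only: mult_ac)
  then have "card (bij_with_records V (Suc n) R) * \<Prod>(V \<inter> {1..Suc n}) \<le> fact (Suc n)"
    using \<open>card E > 0\<close> by (simp only: mult_le_cancel1)
  then show ?case using finite_subset[OF sub fin] by blast
qed

lemma card_permutations_with_records_le:
  assumes "V \<subseteq> {1..n}"
  shows "card {p. p permutes {1..n} \<and> (\<forall>v\<in>V. record_at (inv' p) v)} * \<Prod>V \<le> fact n"
proof -
  let ?P = "{p. p permutes {1..n} \<and> (\<forall>v\<in>V. record_at (inv' p) v)}"
  let ?f = "\<lambda>p :: nat \<Rightarrow> nat. restrict (inv' p) {1..n}"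
  have "V \<inter> {1..n} = V" using assms by auto
  have "card ?P \<le> card (bij_with_records V n {1..n})"
  proof (rule card_inj_on_le)
    show "inj_on ?f ?P"
    proof (rule inj_onI, clarify)
      fix p q :: "nat \<Rightarrow> nat"
      assume p: "p permutes {1..n}" and q: "q permutes {1..n}" and eq: "?f p = ?f q"
      have "inv' p x = inv' q x" for x
      proof (cases "x \<in> {1..n}")
        case True
        then show ?thesis using fun_cong[OF eq, of x] by simp
      next
        case False
        then show ?thesis using permutes_inv[OF p] permutes_inv[OF q] permutes_not_in by metis
      qed
      then have "inv' p = inv' q" by (rule ext)
      then show "p = q" using p q by (metis permutes_inv_inv)
    qed
    show "?f ` ?P \<subseteq> bij_with_records V n {1..n}"
    proof clarify
      fix p assume p: "p permutes {1..n}" and rec: "\<forall>v\<in>V. record_at (inv' p) v"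
      have "bij_betw (inv' p) {1..n} {1..n}" using permutes_inv[OF p] by (rule permutes_imp_bij)
      then have "bij_betw (?f p) {1..n} {1..n}" by (subst bij_betw_restrict_eq)
      moreover have "record_at (?f p) v" if "v \<in> V" for v
        using rec that assms by (auto simp: record_at_def)
      ultimately show "?f p \<in> bij_with_records V n {1..n}"
        by (simp add: bij_with_records_def)
    qed
    show "finite (bij_with_records V n {1..n})" using card_bij_with_records_le[of "{1..n}" n V] by simp
  qed
  then have "card ?P * \<Prod>V \<le> card (bij_with_records V n {1..n}) * \<Prod>V" by (rule mult_le_mono1)
  also have "\<dots> \<le> fact n"
    using card_bij_with_records_le[of "{1..n}" n V] \<open>V \<inter> {1..n} = V\<close> by simp
  finally show ?thesis .
qed

text \<open>
  The word is written from its last letter to its first: at position \<open>v\<close> take, among the remaining letters, one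
  that is largest with respect to \<open>c v\<close>. The order used may thus change from position
  to position, which is what allows a single translation to serve all \<open>k\<close> given permutations.
\<close>

lemma ex_bij_with_prescribed_records:
  fixes c :: "nat \<Rightarrow> 'a \<Rightarrow> nat"
  assumes "finite R" "card R = n"
  shows "\<exists>h. bij_betw h {1..n} R \<and> (\<forall>v\<in>{1..n}. \<forall>u\<in>{1..v}. c v (h u) \<le> c v (h v))"
  using assms
proof (induction n arbitrary: R)
  case 0
  then show ?case by (auto simp: bij_betw_def)
next
  case (Suc n)
  then have "R \<noteq> {}" by auto
  then have "Max (c (Suc n) ` R) \<in> c (Suc n) ` R" using Suc.prems by (intro Max_in) auto
  then obtain e where e: "e \<in> R" and max: "c (Suc n) e = Max (c (Suc n) ` R)" by fastforce
  have max: "c (Suc n) r \<le> c (Suc n) e" if "r \<in> R" for r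
    unfolding max using that Suc.prems by (intro Max_ge) auto
  obtain h where h: "bij_betw h {1..n} (R - {e})"
    "\<And>v u. v \<in> {1..n} \<Longrightarrow> u \<in> {1..v} \<Longrightarrow> c v (h u) \<le> c v (h v)"
    using Suc.IH[of "R - {e}"] Suc.prems e by auto
  let ?h = "h(Suc n := e)"
  have "bij_betw ?h {1..n} (R - {e})" using h(1) by (subst bij_betw_cong[of _ _ h]) auto
  then have "bij_betw ?h ({1..n} \<union> {Suc n}) ((R - {e}) \<union> {e})"
    by (intro bij_betw_combine) (auto simp: bij_betw_def)
  moreover have "{1..n} \<union> {Suc n} = {1..Suc n}" "(R - {e}) \<union> {e} = R" using e by auto
  ultimately have bij: "bij_betw ?h {1..Suc n} R" by simp
  have "c v (?h u) \<le> c v (?h v)" if "v \<in> {1..Suc n}" "u \<in> {1..v}" for u v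
  proof (cases "v = Suc n")
    case True
    moreover have "?h u \<in> R" using bij that by (auto simp: bij_betw_def)
    ultimately show ?thesis using max by simp
  next
    case False
    then show ?thesis using that h(2)[of v u] by auto
  qed
  then show ?case using bij by blast
qed

text \<open>
  The numbers up to \<open>n\<close> can be distributed over \<open>k\<close> classes so that every class has a product of
  at least the \<open>k\<close>-th root of \<open>n!\<close>, up to a factor depending only on \<open>k\<close>. After the first few numbers, blocks
  of \<open>2 * k\<close> consecutive numbers are treated at a time, and class \<open>i\<close> receives the \<open>i\<close>-th number from the bottom and
  the \<open>i\<close>-th from the top of each block. The products of such pairs differ from their
  mean only by a factor \<open>1 + O(k\<^sup>2 / n\<^sup>2)\<close>, and the product of these factors over all blocks
  converges.

  The factor \<open>k * (n + 1) / (n + k)\<close> in the bound, cleared of denominators in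
  the statement, is what makes the induction close: it lies between \<open>1\<close> and \<open>k\<close>, and
  from \<open>n\<close> to \<open>n + 2 * k\<close> it grows at least by the loss incurred in one block.
\<close>

lemma ex_balanced_colouring:
  assumes "k \<ge> 1"
  shows "\<exists>f. (\<forall>v\<in>{1..n}. f v < k) \<and>
    (\<forall>i<k. fact n * (real (n + k)) ^ k
       \<le> (fact (2 * k) * real k * real (n + 1) * real (\<Prod>{v\<in>{1..n}. f v = i})) ^ k)"
proof (induction n rule: less_induct)
  case (less n)
  show ?case
  proof (cases "n < 2 * k")
    case True
    show ?thesis
    proof (intro exI[of _ "\<lambda>_. 0"] conjI allI impI ballI)
      show "0 < k" using assms by simp
      fix i assume "i < k"
      have "fact n \<le> (fact (2 * k) :: real) ^ 1" using True by (simp add: fact_mono)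
      also have "\<dots> \<le> fact (2 * k) ^ k" using assms by (intro power_increasing) auto
      finally have 1: "fact n \<le> (fact (2 * k) :: real) ^ k" .
      have "n + k \<le> k * (n + 1)" using assms by (cases k) auto
      then have 2: "real (n + k) \<le> real k * real (n + 1)" by (metis of_nat_le_iff of_nat_mult)
      have "\<Prod>{v\<in>{1..n}. 0 = i} \<ge> 1" by (rule prod_ge_1) auto
      then have 3: "real (\<Prod>{v\<in>{1..n}. 0 = i}) \<ge> 1" by linarith
      have "fact n * real (n + k) ^ k \<le> fact (2 * k) ^ k * (real k * real (n + 1)) ^ k * 1 ^ k"
        using 1 2 by (simp add: mult_mono power_mono)
      also have "\<dots> \<le> fact (2 * k) ^ k * (real k * real (n + 1)) ^ k * real (\<Prod>{v\<in>{1..n}. 0 = i}) ^ k"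
        using 3 by (intro mult_left_mono power_mono) auto
      finally show "fact n * real (n + k) ^ k \<le>
          (fact (2 * k) * real k * real (n + 1) * real (\<Prod>{v\<in>{1..n}. 0 = i})) ^ k"
        by (simp only: power_mult_distrib mult.assoc)
    qed
  next
    case False
    define m where "m = n - 2 * k"
    have n: "n = m + 2 * k" and "m < n" using False assms by (auto simp: m_def)
    obtain f where f: "\<And>v. v \<in> {1..m} \<Longrightarrow> f v < k"
      and bound: "\<And>i. i < k \<Longrightarrow> fact m * (real (m + k)) ^ k
       \<le> (fact (2 * k) * real k * real (m + 1) * real (\<Prod>{v\<in>{1..m}. f v = i})) ^ k"
      using less.IH[OF \<open>m < n\<close>] by blast
    \<comment> \<open>Colour the new block \<open>m + 1, \<dots>, m + 2 * k\<close> upwards in its lower half and downwards in its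
      upper half.\<close>
    define f' where "f' v = (if v \<le> m then f v else if v \<le> m + k then v - m - 1 else n - v)" for v
    show ?thesis
    proof (intro exI[of _ f'] conjI allI impI ballI)
      fix v assume "v \<in> {1..n}"
      then show "f' v < k" using f n by (auto simp: f'_def)
    next
      fix i assume i: "i < k"
      define P where "P = \<Prod>{v\<in>{1..m}. f v = i}"
      have split: "{v\<in>{1..n}. f' v = i} = {v\<in>{1..m}. f v = i} \<union> {m + 1 + i, m + 2 * k - i}"
        using i n by (auto simp: f'_def split: if_splits)
      have "\<Prod>{v\<in>{1..n}. f' v = i} = P * ((m + 1 + i) * (m + 2 * k - i))"
        unfolding split P_def using i by (subst prod.union_disjoint) auto
      \<comment> \<open>Of all pairs with a given sum, the outermost one has the smallest product, the innermost the largest.\<close>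
      moreover have "(m + 1) * (m + 2 * k) \<le> (m + 1 + i) * (m + 2 * k - i)"
      proof -
        obtain j where j: "2 * k = 2 * i + 2 + j" using i by (metis Suc_leI add.commute add_2_eq_Suc' le_Suc_ex mult_Suc_right mult_le_mono2)
        show ?thesis unfolding j by (simp add: algebra_simps)
      qed
      ultimately have "P * ((m + 1) * (m + 2 * k)) \<le> \<Prod>{v\<in>{1..n}. f' v = i}" by simp
      then have prod: "real P * (real (m + 1) * real (m + 2 * k)) \<le> real (\<Prod>{v\<in>{1..n}. f' v = i})"
        by (metis of_nat_le_iff of_nat_mult)
      have fact_n: "fact n \<le> fact m * (real (m + k) * real (m + k + 1)) ^ k"
      proof -
        \<comment> \<open>Group the block into pairs from the middle outwards.\<close>
        have "fact n = fact m * real (\<Prod>j<k. (m + k - j) * (m + k + 1 + j))"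
        proof -
          have "(fact (m + k + j) :: nat) = fact (m + k - j) * (\<Prod>i<j. (m + k - i) * (m + k + 1 + i))"
            if "j \<le> k" for j
            using that
          proof (induction j)
            case (Suc j)
            have "(fact (m + k - j) :: nat) = (m + k - j) * fact (m + k - Suc j)"
              using Suc.prems by (simp add: fact_reduce Suc_diff_Suc)
            moreover have "(fact (m + k + Suc j) :: nat) = (m + k + 1 + j) * fact (m + k + j)" by simp
            ultimately have "(fact (m + k + Suc j) :: nat) = (m + k + 1 + j)
                * ((m + k - j) * fact (m + k - Suc j) * (\<Prod>i<j. (m + k - i) * (m + k + 1 + i)))"
              using Suc by (metis Suc_leD)
            then show ?case by (simp only: prod.lessThan_Suc mult_ac)
          qed simp
          from this[of k] have "(fact (m + k + k) :: nat) = fact m * (\<Prod>j<k. (m + k - j) * (m + k + 1 + j))"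
            by simp
          then have "real (fact n) = real (fact m * (\<Prod>j<k. (m + k - j) * (m + k + 1 + j)))"
            unfolding n mult_2 add.assoc[symmetric] by (rule arg_cong)
          then show ?thesis by (simp only: of_nat_fact of_nat_mult)
        qed
        also have "real (\<Prod>j<k. (m + k - j) * (m + k + 1 + j)) \<le> (\<Prod>j<k. real (m + k) * real (m + k + 1))"
          unfolding of_nat_prod
        proof (intro prod_mono conjI)
          fix j assume "j \<in> {..<k}"
          then obtain l where l: "k = l + j" by (metis add.commute lessThan_iff less_imp_add_positive)
          have "(m + k - j) * (m + k + 1 + j) \<le> (m + k) * (m + k + 1)"
            unfolding l by (simp add: algebra_simps)
          then show "real ((m + k - j) * (m + k + 1 + j)) \<le> real (m + k) * real (m + k + 1)"
            by (metis of_nat_le_iff of_nat_mult)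
        qed (rule of_nat_0_le_iff)
        finally show ?thesis by simp
      qed
      have "(m + k + 1) * (n + k) \<le> (n + 1) * (m + 2 * k)"
        using assms unfolding n by (simp add: algebra_simps)
      then have ratio: "real (m + k + 1) * real (n + k) \<le> real (n + 1) * real (m + 2 * k)"
        by (metis of_nat_le_iff of_nat_mult)
      have "fact n * real (n + k) ^ k
          \<le> fact m * (real (m + k) * real (m + k + 1)) ^ k * real (n + k) ^ k"
        using fact_n by (rule mult_right_mono) simp
      also have "\<dots> = fact m * real (m + k) ^ k * (real (m + k + 1) * real (n + k)) ^ k"
        by (simp only: power_mult_distrib mult_ac)
      also have "\<dots> \<le> (fact (2 * k) * real k * real (m + 1) * real P) ^ k
          * (real (n + 1) * real (m + 2 * k)) ^ k"
      proof (rule mult_mono)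
        show "fact m * real (m + k) ^ k \<le> (fact (2 * k) * real k * real (m + 1) * real P) ^ k"
          unfolding P_def by (rule bound) fact
        show "(real (m + k + 1) * real (n + k)) ^ k \<le> (real (n + 1) * real (m + 2 * k)) ^ k"
          using ratio by (rule power_mono) simp
      qed simp_all
      also have "\<dots> = (fact (2 * k) * real k * real (n + 1) * (real P * (real (m + 1) * real (m + 2 * k)))) ^ k"
        by (simp only: power_mult_distrib mult_ac)
      also have "\<dots> \<le> (fact (2 * k) * real k * real (n + 1) * real (\<Prod>{v\<in>{1..n}. f' v = i})) ^ k"
        using prod by (intro power_mono mult_left_mono) auto
      finally show "fact n * real (n + k) ^ k
          \<le> (fact (2 * k) * real k * real (n + 1) * real (\<Prod>{v\<in>{1..n}. f' v = i})) ^ k" .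
    qed
  qed
qed

lemma square_times_fact_le:
  assumes "k \<ge> 1"
  shows "real k * (fact (2 * k) * real k) \<le> fact (3 * k + 1)"
proof -
  have "k * k * fact (2 * k) \<le> (2 * k + 2) * (2 * k + 1) * fact (2 * k)"
    by (intro mult_le_mono) auto
  then have "k * (fact (2 * k) * k) \<le> (2 * k + 2) * ((2 * k + 1) * fact (2 * k))"
    by (simp only: mult_ac)
  also have "\<dots> = fact (2 * k + 2)" by simp
  also have "\<dots> \<le> fact (3 * k + 1)" using assms by (intro fact_mono) simp
  finally show ?thesis by (metis of_nat_fact of_nat_le_iff of_nat_mult)
qed

text \<open>
  The universal set consists of the permutations whose inverse has records at all positions of
  at least one class of the balanced colouring. For a given family \<open>w\<close> of permutations, a word \<open>h\<close> is chosen
  whose image under the inverse of \<open>w i\<close> has records at the positions of class \<open>i\<close>, for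
  all \<open>i\<close> at once; the inverse of \<open>h\<close> is the required translation.
\<close>

lemma sym_group_universal_set:
  assumes "k \<ge> 1"
  shows "\<exists>U. universal_set (sym_group n) k U \<and>
    real (card U) \<le> fact (3 * k + 1) * real (order (sym_group n)) powr (1 - 1 / real k)"
proof -
  define C where "C = fact (2 * k) * real k"
  obtain f where f: "\<And>v. v \<in> {1..n} \<Longrightarrow> f v < k"
    and bound: "\<And>i. i < k \<Longrightarrow> fact n * (real (n + k)) ^ k
       \<le> (C * real (n + 1) * real (\<Prod>{v\<in>{1..n}. f v = i})) ^ k"
    using ex_balanced_colouring[OF assms, of n] unfolding C_def by blast
  define V where "V i = {v\<in>{1..n}. f v = i}" for i
  define Y where "Y i = {p. p permutes {1..n} \<and> (\<forall>v\<in>V i. record_at (inv' p) v)}" for i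
  define N where "N = order (sym_group n)"
  have N: "N = fact n" by (simp add: N_def Coset.order_def sym_group_card_carrier)
  then have "N > 0" by simp
  have root: "real N powr (1 / real k) \<le> C * real (\<Prod>(V i))" if "i < k" for i
  proof -
    have "C \<ge> 0" by (simp add: C_def)
    have "real N * real (n + k) ^ k \<le> (C * real (n + 1) * real (\<Prod>(V i))) ^ k"
      using bound[OF that] by (simp add: N V_def)
    also have "\<dots> = (C * real (\<Prod>(V i))) ^ k * real (n + 1) ^ k"
      by (simp only: power_mult_distrib mult_ac)
    also have "\<dots> \<le> (C * real (\<Prod>(V i))) ^ k * real (n + k) ^ k"
      using assms \<open>C \<ge> 0\<close> by (intro mult_left_mono power_mono zero_le_power mult_nonneg_nonneg of_nat_0_le_iff) auto
    finally have "real N \<le> (C * real (\<Prod>(V i))) ^ k"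
      using assms by (subst (asm) mult_le_cancel_right) auto
    then have "real N powr (1 / real k) \<le> ((C * real (\<Prod>(V i))) ^ k) powr (1 / real k)"
      by (intro powr_mono2) auto
    moreover have "\<Prod>(V i) > 0" by (rule prod_pos) (auto simp: V_def)
    then have "C * real (\<Prod>(V i)) > 0" unfolding C_def using assms by (intro mult_pos_pos) (simp_all del: of_nat_prod)
    then have "(C * real (\<Prod>(V i))) ^ k = (C * real (\<Prod>(V i))) powr real k"
      by (simp only: powr_realpow)
    moreover have "((C * real (\<Prod>(V i))) powr real k) powr (1 / real k) = C * real (\<Prod>(V i))"
      unfolding powr_powr using assms \<open>C * real (\<Prod>(V i)) > 0\<close> by (simp del: of_nat_prod)
    ultimately show ?thesis by simp
  qed
  define U where "U = (\<Union>i<k. Y i)"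
  have "universal_set (sym_group n) k U"
    unfolding universal_set_def
  proof (intro conjI allI impI)
    show "U \<subseteq> carrier (sym_group n)" by (auto simp: U_def Y_def sym_group_carrier)
    fix W assume W: "W \<subseteq> carrier (sym_group n) \<and> finite W \<and> card W = k"
    then obtain w where w: "bij_betw w {0..<k} W" using ex_bij_betw_nat_finite by blast
    have perm: "w i permutes {1..n}" if "i < k" for i
    proof -
      have "w i \<in> W" using bij_betwE[OF w] that by simp
      then show ?thesis using W sym_group_carrier by blast
    qed
    obtain h where h: "bij_betw h {1..n} {1..n}"
      "\<And>v u. v \<in> {1..n} \<Longrightarrow> u \<in> {1..v} \<Longrightarrow> inv' (w (f v)) (h u) \<le> inv' (w (f v)) (h v)"
      using ex_bij_with_prescribed_records[of "{1..n}" n "\<lambda>v. inv' (w (f v))"] by auto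
    define p where "p x = (if x \<in> {1..n} then h x else x)" for x
    have "p permutes {1..n}"
    proof (rule bij_imp_permutes)
      show "bij_betw p {1..n} {1..n}"
        using h(1) by (subst bij_betw_cong[of _ _ h]) (simp_all add: p_def)
    qed (auto simp: p_def)
    then have p: "inv' p permutes {1..n}" "inv' (inv' p) = p"
      by (auto simp: permutes_inv permutes_inv_inv)
    have "inv' p \<circ> w i \<in> Y i" if "i < k" for i
    proof -
      have "inv' (inv' p \<circ> w i) = inv' (w i) \<circ> p"
        using p perm[OF that] by (subst o_inv_distrib) (auto simp: permutes_bij)
      moreover have "inv' (w i) (p u) \<le> inv' (w i) (p v)" if "v \<in> V i" "u \<in> {1..v}" for u v
        using h(2)[of v u] that by (auto simp: V_def p_def)
      ultimately show ?thesis
        using permutes_compose[OF perm[OF that] p(1)] by (simp add: Y_def record_at_def)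
    qed
    then have "inv' p <#\<^bsub>sym_group n\<^esub> W \<subseteq> U"
      using w by (fastforce simp: l_coset_def sym_group_mult U_def bij_betw_def)
    then show "\<exists>g\<in>carrier (sym_group n). g <#\<^bsub>sym_group n\<^esub> W \<subseteq> U"
      using p(1) by (auto simp: sym_group_carrier)
  qed
  moreover have "real (card U) \<le> fact (3 * k + 1) * real N powr (1 - 1 / real k)"
  proof -
    have "real (card (Y i)) * real N powr (1 / real k) \<le> C * real N" if "i < k" for i
    proof -
      have "card (Y i) * \<Prod>(V i) \<le> N"
        unfolding Y_def N by (rule card_permutations_with_records_le) (auto simp: V_def)
      then have "real (card (Y i)) * real (\<Prod>(V i)) \<le> real N" by (metis of_nat_le_iff of_nat_mult)
      then have "C * (real (card (Y i)) * real (\<Prod>(V i))) \<le> C * real N"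
        by (intro mult_left_mono) (auto simp: C_def)
      moreover have "real (card (Y i)) * real N powr (1 / real k)
          \<le> real (card (Y i)) * (C * real (\<Prod>(V i)))"
        using root[OF that] by (rule mult_left_mono) simp
      ultimately show ?thesis by (simp only: mult_ac)
    qed
    then have "(\<Sum>i<k. real (card (Y i)) * real N powr (1 / real k)) \<le> (\<Sum>i<k. C * real N)"
      by (intro sum_mono) auto
    then have "(\<Sum>i<k. real (card (Y i))) * real N powr (1 / real k) \<le> real k * C * real N"
      by (simp add: sum_distrib_right)
    moreover have "real (card U) \<le> (\<Sum>i<k. real (card (Y i)))"
      unfolding U_def using card_UN_le[of "{..<k}" Y] by (simp flip: of_nat_sum)
    ultimately have "real (card U) * real N powr (1 / real k) \<le> real k * C * real N"
      by (meson mult_right_mono order_trans powr_ge_zero)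
    also have "\<dots> \<le> fact (3 * k + 1) * real N"
      using square_times_fact_le[OF assms] by (intro mult_right_mono) (auto simp: C_def)
    finally show ?thesis using \<open>N > 0\<close> by (simp add: powr_diff field_simps)
  qed
  ultimately show ?thesis unfolding N_def by blast
qed

section \<open>Abelian groups\<close>

text \<open>
  Take a maximal packing of disjoint translates of \<open>B\<close>: any further translate meets one of them.
\<close>

lemma (in group) ex_covering_translates:
  assumes fin: "finite (carrier G)" and B: "B \<subseteq> carrier G" "B \<noteq> {}"
  shows "\<exists>T \<subseteq> carrier G. card T * card B \<le> order G \<and>
    (\<forall>z\<in>carrier G. \<exists>t\<in>T. \<exists>b\<in>B. \<exists>b'\<in>B. t \<otimes> b = z \<otimes> b')"
proof -
  let ?packing = "\<lambda>T. T \<subseteq> carrier G \<and> pairwise (\<lambda>t t'. disjnt (t <# B) (t' <# B)) T"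
  have bounded: "card T \<le> order G" if "?packing T" for T
    using that card_mono[OF fin] by (auto simp: Coset.order_def)
  have "?packing {}" by simp
  then obtain T where T: "?packing T" and max: "\<And>T'. ?packing T' \<Longrightarrow> card T' \<le> card T"
  proof -
    have "\<exists>T. ?packing T \<and> (\<forall>T'. ?packing T' \<longrightarrow> card T' \<le> card T)"
      by (rule ex_has_greatest_nat[of ?packing "{}" card "Suc (order G)"])
        (use bounded in \<open>simp_all add: less_Suc_eq_le\<close>)
    then show thesis using that by auto
  qed
  have finT: "finite T" using T fin finite_subset by blast
  have translate: "card (t <# B) = card B" "t <# B \<subseteq> carrier G" if "t \<in> carrier G" for t
  proof -
    have "t <# B = (\<lambda>b. t \<otimes> b) ` B" by (auto simp: l_coset_def)
    moreover have "inj_on (\<lambda>b. t \<otimes> b) B"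
      using inj_on_cmult[OF that] B(1) by (rule inj_on_subset)
    ultimately show "card (t <# B) = card B" by (simp add: card_image)
    show "t <# B \<subseteq> carrier G" using that B l_coset_subset_G by blast
  qed
  have "card (\<Union>t\<in>T. t <# B) = (\<Sum>t\<in>T. card (t <# B))"
  proof (rule card_UN_disjoint[OF finT])
    show "\<forall>t\<in>T. finite (t <# B)" using T translate(2) fin by (meson finite_subset subsetD)
    show "\<forall>t\<in>T. \<forall>t'\<in>T. t \<noteq> t' \<longrightarrow> (t <# B) \<inter> (t' <# B) = {}"
      using T by (auto simp: pairwise_def disjnt_def)
  qed
  also have "\<dots> = card T * card B" using T translate(1) by (simp add: subset_iff)
  finally have "card T * card B = card (\<Union>t\<in>T. t <# B)" ..
  also have "\<dots> \<le> order G"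
    unfolding Coset.order_def using T translate(2) by (intro card_mono[OF fin]) blast
  finally have card: "card T * card B \<le> order G" .
  have "\<exists>t\<in>T. \<exists>b\<in>B. \<exists>b'\<in>B. t \<otimes> b = z \<otimes> b'" if z: "z \<in> carrier G" for z
  proof (rule ccontr)
    assume no: "\<not> ?thesis"
    then have "z \<notin> T" using B by blast
    have "disjnt (t <# B) (z <# B)" if "t \<in> T" for t
      using no that by (auto simp: disjnt_def l_coset_def)
    then have "?packing (insert z T)"
      using T z by (auto simp: pairwise_insert disjnt_sym)
    then have "card (insert z T) \<le> card T" by (rule max)
    then show False using \<open>z \<notin> T\<close> finT by simp
  qed
  then show ?thesis using T card by blast
qed

text \<open>
  The sets that replace intervals: a block of consecutive cosets of a subgroup. Unlike
  subgroups they exist in all sizes, up to a factor of two, and unlike arbitrary sets they have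
  small difference sets.
\<close>

definition progression :: "('a, 'b) monoid_scheme \<Rightarrow> 'a set \<Rightarrow> 'a \<Rightarrow> nat \<Rightarrow> 'a set"
  where "progression G H x L = (\<lambda>(h, i). h \<otimes>\<^bsub>G\<^esub> x [^]\<^bsub>G\<^esub> i) ` (H \<times> {..<L})"

definition proper :: "('a, 'b) monoid_scheme \<Rightarrow> 'a set \<Rightarrow> 'a \<Rightarrow> nat \<Rightarrow> bool"
  where "proper G H x L \<longleftrightarrow> subgroup H G \<and> x \<in> carrier G \<and>
    inj_on (\<lambda>(h, i). h \<otimes>\<^bsub>G\<^esub> x [^]\<^bsub>G\<^esub> (i::nat)) (H \<times> {..<L})"

lemma progressionI: "h \<in> H \<Longrightarrow> i < L \<Longrightarrow> h \<otimes>\<^bsub>G\<^esub> x [^]\<^bsub>G\<^esub> i \<in> progression G H x L"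
  by (auto simp: progression_def)

lemma progressionE:
  assumes "c \<in> progression G H x L"
  obtains h i where "h \<in> H" "i < L" "c = h \<otimes>\<^bsub>G\<^esub> x [^]\<^bsub>G\<^esub> i"
  using assms by (auto simp: progression_def)

lemma card_progression:
  assumes "proper G H x L"
  shows "card (progression G H x L) = card H * L"
  using assms by (simp add: progression_def proper_def card_image card_cartesian_product)

lemma proper_shorter: "proper G H x L \<Longrightarrow> l \<le> L \<Longrightarrow> proper G H x l"
  unfolding proper_def by (auto elim!: inj_on_subset)

lemma (in group) progression_subset:
  assumes "proper G H x L"
  shows "progression G H x L \<subseteq> carrier G"
  using assms subgroup.subset by (fastforce simp: progression_def proper_def)

lemma (in comm_group) subgroup_adjoin:
  assumes fin: "finite (carrier G)" and K: "subgroup K G" and x: "x \<in> carrier G"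
  shows "subgroup {h \<otimes> x [^] i | h i. h \<in> K \<and> (i::nat) \<in> UNIV} G" (is "subgroup ?S G")
proof (rule subgroupI)
  have KG: "h \<in> carrier G" if "h \<in> K" for h using that subgroup.subset[OF K] by blast
  show "?S \<subseteq> carrier G" using KG x by auto
  show "?S \<noteq> {}" using subgroup.one_closed[OF K] by auto
  fix a assume "a \<in> ?S"
  then obtain h i where a: "h \<in> K" "a = h \<otimes> x [^] (i::nat)" by blast
  have "order G \<ge> 1" using fin order_gt_0_iff_finite by (simp add: Suc_leI)
  then have "x [^] (i * (order G - 1)) \<otimes> x [^] i = x [^] (order G * i)"
    using x by (simp add: nat_pow_mult algebra_simps)
  also have "\<dots> = \<one>" using x by (simp add: pow_order_eq_1 flip: nat_pow_pow)
  finally have "inv (x [^] i) = x [^] (i * (order G - 1))"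
    using x by (intro inv_equality) auto
  then have "inv a = inv h \<otimes> x [^] (i * (order G - 1))"
    using a KG x by (simp add: inv_mult)
  then show "inv a \<in> ?S" using a subgroup.m_inv_closed[OF K] by blast
  fix b assume "b \<in> ?S"
  then obtain h' j where b: "h' \<in> K" "b = h' \<otimes> x [^] (j::nat)" by blast
  have "a \<otimes> b = (h \<otimes> h') \<otimes> (x [^] i \<otimes> x [^] j)"
    using a b KG x by (simp add: m_ac)
  then have "a \<otimes> b = (h \<otimes> h') \<otimes> x [^] (i + j)" using x by (simp add: nat_pow_mult)
  then show "a \<otimes> b \<in> ?S" using a b subgroup.m_closed[OF K] by blast
qed

text \<open>
  Take a largest subgroup \<open>K\<close> of \<open>H\<close> with at most \<open>m\<close> elements and as many cosets of \<open>K\<close> in the direction of some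
  \<open>x\<close> outside \<open>K\<close> as fit. Two of these cosets cannot coincide, since then the
  subgroup generated by \<open>K\<close> and \<open>x\<close> would still have at most \<open>m\<close> elements.
\<close>

lemma (in comm_group) ex_progression_of_size:
  assumes fin: "finite (carrier G)" and H: "subgroup H G" and m: "1 \<le> m" "m \<le> card H"
  shows "\<exists>K x l. proper G K x l \<and> progression G K x l \<subseteq> H \<and> card K * l \<le> m \<and> m < 2 * (card K * l)"
proof -
  let ?small = "\<lambda>K. subgroup K G \<and> K \<subseteq> H \<and> card K \<le> m"
  have "?small {\<one>}" using triv_subgroup subgroup.one_closed[OF H] m by auto
  then obtain K where K: "?small K" and max: "\<And>K'. ?small K' \<Longrightarrow> card K' \<le> card K"
  proof -
    have "\<exists>K. ?small K \<and> (\<forall>K'. ?small K' \<longrightarrow> card K' \<le> card K)"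
      by (rule ex_has_greatest_nat[of ?small "{\<one>}" card "Suc m"]) (use \<open>?small {\<one>}\<close> in \<open>simp_all add: less_Suc_eq_le\<close>)
    then show thesis using that by auto
  qed
  have KG: "h \<in> carrier G" if "h \<in> K" for h using that K subgroup.subset by blast
  have HG: "h \<in> carrier G" if "h \<in> H" for h using that H subgroup.subset by blast
  have "finite K" using KG fin by (meson finite_subset subsetI)
  then have "card K > 0" using K subgroup.one_closed card_gt_0_iff by blast
  show ?thesis
  proof (cases "K = H")
    case True
    have "proper G K \<one> 1" using K KG by (auto simp: proper_def inj_on_def)
    moreover have "progression G K \<one> 1 \<subseteq> H" using True KG by (auto simp: progression_def)
    ultimately show ?thesis using True m \<open>card K > 0\<close> K by (intro exI[of _ K] exI[of _ \<one>] exI[of _ 1]) auto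
  next
    case False
    then obtain x where x: "x \<in> H" "x \<notin> K" using K by blast
    then have xG: "x \<in> carrier G" using HG by blast
    define l where "l = m div card K"
    have "l \<ge> 1" unfolding l_def using K \<open>card K > 0\<close> by (simp add: div_greater_zero_iff Suc_leI)
    have "card K * l \<le> m" by (simp add: l_def)
    have "m < card K * l + card K"
      unfolding l_def using mod_less_divisor[OF \<open>card K > 0\<close>, of m] mult_div_mod_eq[of "card K" m] by linarith
    also have "card K * l + card K \<le> 2 * (card K * l)" using \<open>l \<ge> 1\<close> by simp
    finally have "m < 2 * (card K * l)" .
    have collision: False if "i < j" "j < l" "h \<in> K" "h' \<in> K" "h \<otimes> x [^] i = h' \<otimes> x [^] j" for i j :: nat and h h'
    proof -
      define d where "d = j - i"
      have d: "d > 0" "d < l" "j = d + i" using that by (auto simp: d_def)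
      have "h \<otimes> x [^] i = (h' \<otimes> x [^] d) \<otimes> x [^] i"
        using that d KG xG by (simp add: m_assoc nat_pow_mult)
      then have "h = h' \<otimes> x [^] d" using that KG xG by simp
      then have "x [^] d = inv h' \<otimes> h" using that KG xG by (simp add: inv_solve_left)
      then have xd: "x [^] d \<in> K" using that K by (simp add: subgroup.m_closed subgroup.m_inv_closed)
      define S where "S = {h \<otimes> x [^] i | h i. h \<in> K \<and> (i::nat) \<in> UNIV}"
      have S: "subgroup S G" unfolding S_def using K xG fin by (intro subgroup_adjoin) auto
      have "x [^] i \<in> H" for i :: nat
        using x(1) H by (induction i) (auto simp: subgroup.one_closed subgroup.m_closed)
      then have "S \<subseteq> H" unfolding S_def using K H by (auto intro: subgroup.m_closed)
      have "S \<subseteq> progression G K x d"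
      proof
        fix s assume "s \<in> S"
        then obtain h i where s: "h \<in> K" "s = h \<otimes> x [^] (i::nat)" unfolding S_def by blast
        have "(x [^] d) [^] n \<in> K" for n :: nat
          using xd K by (induction n) (auto simp: subgroup.one_closed subgroup.m_closed)
        then have "h \<otimes> (x [^] d) [^] (i div d) \<in> K"
          using s K by (simp add: subgroup.m_closed)
        moreover have "s = (h \<otimes> (x [^] d) [^] (i div d)) \<otimes> x [^] (i mod d)"
          using s KG xG by (simp add: m_assoc nat_pow_pow nat_pow_mult)
        ultimately show "s \<in> progression G K x d" using d progressionI by (metis mod_less_divisor)
      qed
      then have "card S \<le> card (progression G K x d)"
        using \<open>finite K\<close> by (intro card_mono) (auto simp: progression_def)
      also have "\<dots> \<le> card (K \<times> {..<d})"
        unfolding progression_def using \<open>finite K\<close> by (intro card_image_le) simp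
      also have "\<dots> = card K * d" by (simp add: card_cartesian_product)
      also have "\<dots> \<le> card K * l" using d by simp
      finally have "card S \<le> m" using \<open>card K * l \<le> m\<close> by simp
      then have "card S \<le> card K" using max S \<open>S \<subseteq> H\<close> by blast
      moreover have "K \<subset> S"
      proof
        have "h \<otimes> x [^] (0::nat) \<in> S" if "h \<in> K" for h unfolding S_def using that by blast
        then show "K \<subseteq> S" using KG by auto
        have "\<one> \<otimes> x [^] (1::nat) \<in> S" unfolding S_def using K subgroup.one_closed by blast
        then show "K \<noteq> S" using x xG by auto
      qed
      moreover have "finite S" using \<open>S \<subseteq> H\<close> HG fin by (meson finite_subset subsetI)
      ultimately show False using psubset_card_mono[of S K] by simp
    qed
    have "proper G K x l"
      unfolding proper_def
    proof (intro conjI inj_onI, goal_cases)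
      case (3 p p')
      then obtain h i h' j where p: "p = (h, i)" "p' = (h', j)" "h \<in> K" "h' \<in> K" "i < l" "j < l"
        "h \<otimes> x [^] i = h' \<otimes> x [^] j" by auto
      then have "i = j" using collision[of i j h h'] collision[of j i h' h] by (metis nat_neq_iff)
      then show ?case using p KG xG by simp
    qed (use K xG in auto)
    moreover have "progression G K x l \<subseteq> H"
    proof -
      have "x [^] i \<in> H" for i :: nat
        using x(1) H by (induction i) (auto simp: subgroup.one_closed subgroup.m_closed)
      then show ?thesis using K H by (auto simp: progression_def intro: subgroup.m_closed)
    qed
    ultimately show ?thesis using \<open>card K * l \<le> m\<close> \<open>m < 2 * (card K * l)\<close> by blast
  qed
qed

text \<open>
  One refinement step. Every translate of the large progression contains one of few prescribed
  translates of a small one, of any size \<open>m\<close> up to half of the large one; the number of prescribed translates is optimal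
  up to the factor 4. The small progression is shorter and has the same direction if \<open>m\<close> exceeds the order of
  \<open>H\<close>, and otherwise lies inside \<open>H\<close>; in both cases it stays within the first \<open>l0\<close> cosets. The
  prescribed translates come from the covering lemma applied to the first \<open>L'\<close> cosets,
  where \<open>L'\<close> is the largest number for which the difference set of \<open>L'\<close> consecutive cosets, lengthened
  by a block of \<open>l0\<close> cosets, fits into \<open>L\<close> cosets.
\<close>

lemma (in comm_group) ex_refined_progression:
  assumes fin: "finite (carrier G)" and B: "proper G H x L" and m: "1 \<le> m" "2 * m \<le> card H * L"
  shows "\<exists>K y l T. proper G K y l \<and> card K * l \<le> m \<and> m < 2 * (card K * l) \<and>
    T \<subseteq> carrier G \<and> card T * (card H * L) \<le> 4 * order G \<and>
    (\<forall>g\<in>carrier G. \<exists>t\<in>T. t <# progression G K y l \<subseteq> g <# progression G H x L)"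
proof -
  have H: "subgroup H G" and x: "x \<in> carrier G" using B by (auto simp: proper_def)
  have HG: "h \<in> carrier G" if "h \<in> H" for h using that H subgroup.subset by blast
  have "card H > 0" "L > 0" using m by (auto intro!: Nat.gr0I)
  obtain K y l l0 where K: "proper G K y l" "card K * l \<le> m" "m < 2 * (card K * l)"
    and l0: "progression G K y l \<subseteq> progression G H x l0" "l0 \<le> L" "l0 = 1 \<or> 2 * l0 \<le> L"
  proof (cases "m \<le> card H")
    case True
    obtain K y l where K: "proper G K y l" "progression G K y l \<subseteq> H" "card K * l \<le> m" "m < 2 * (card K * l)"
      using ex_progression_of_size[OF fin H m(1) True] by blast
    have "h \<in> progression G H x 1" if "h \<in> H" for h
      using progressionI[OF that, of 0 1 G x] HG[OF that] by simp
    then show thesis using that[of K y l 1] K \<open>L > 0\<close> by auto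
  next
    case False
    define l where "l = m div card H"
    have "l \<ge> 1" unfolding l_def using False \<open>card H > 0\<close> by (simp add: div_greater_zero_iff Suc_leI)
    have le: "card H * l \<le> m" by (simp add: l_def)
    have "m < card H * l + card H"
      unfolding l_def using mod_less_divisor[OF \<open>card H > 0\<close>, of m] mult_div_mod_eq[of "card H" m] by linarith
    also have "card H * l + card H \<le> 2 * (card H * l)" using \<open>l \<ge> 1\<close> by simp
    finally have lt: "m < 2 * (card H * l)" .
    have "card H * (2 * l) = 2 * (card H * l)" by simp
    also have "\<dots> \<le> card H * L" using le m(2) by linarith
    finally have "2 * l \<le> L" using \<open>card H > 0\<close> by (simp only: mult_le_cancel1)
    then show thesis using that[of H x l l] le lt proper_shorter[OF B, of l] by simp
  qed
  define L' where "L' = (L + 2 - l0) div 2"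
  have L': "L \<le> 4 * L'" "2 * L' + l0 \<le> L + 2" "L' \<le> L" "L' > 0"
    using l0(2,3) \<open>L > 0\<close> unfolding L'_def by auto
  let ?B' = "progression G H x L'"
  have B': "proper G H x L'" using proper_shorter[OF B L'(3)] .
  have "?B' \<noteq> {}" using subgroup.one_closed[OF H] L'(4) by (auto simp: progression_def)
  then obtain T where T: "T \<subseteq> carrier G" "card T * card ?B' \<le> order G"
    and cover: "\<And>z. z \<in> carrier G \<Longrightarrow> \<exists>t\<in>T. \<exists>b\<in>?B'. \<exists>b'\<in>?B'. t \<otimes> b = z \<otimes> b'"
    using ex_covering_translates[OF fin progression_subset[OF B']] by blast
  have "card T * (card H * L) \<le> card T * (card H * (4 * L'))"
    using L'(1) by (intro mult_le_mono2)
  also have "\<dots> = 4 * (card T * card ?B')" by (simp add: card_progression[OF B'])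
  finally have card_T: "card T * (card H * L) \<le> 4 * order G" using T(2) by linarith
  have "\<exists>t\<in>T. t <# progression G K y l \<subseteq> g <# progression G H x L" if g: "g \<in> carrier G" for g
  proof -
    \<comment> \<open>The shift by \<open>L' - 1\<close> makes all exponents of the difference set nonnegative.\<close>
    have "g \<otimes> x [^] (L' - 1) \<in> carrier G" using g x by simp
    from cover[OF this] obtain t b b' where t: "t \<in> T" "b \<in> ?B'" "b' \<in> ?B'"
      "t \<otimes> b = g \<otimes> x [^] (L' - 1) \<otimes> b'" by blast
    obtain h i where b: "h \<in> H" "i < L'" "b = h \<otimes> x [^] i" using t(2) by (rule progressionE)
    obtain h' j where b': "h' \<in> H" "j < L'" "b' = h' \<otimes> x [^] j" using t(3) by (rule progressionE)
    have tG: "t \<in> carrier G" using t T by blast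
    have "t \<otimes> c \<in> g <# progression G H x L" if "c \<in> progression G K y l" for c
    proof -
      have "c \<in> progression G H x l0" using that l0(1) by blast
      then obtain h2 a where c: "h2 \<in> H" "a < l0" "c = h2 \<otimes> x [^] a" by (rule progressionE)
      define e where "e = L' - 1 - i + j + a"
      have e: "(L' - 1) + (j + a) = e + i" "e < L" using b(2) b'(2) c(2) L'(2) by (auto simp: e_def)
      note closed = g x tG HG[OF b(1)] HG[OF b'(1)] HG[OF c(1)]
      have "(t \<otimes> c) \<otimes> b = (t \<otimes> b) \<otimes> c" using closed b c by (simp add: m_ac)
      also have "\<dots> = g \<otimes> (h' \<otimes> h2) \<otimes> (x [^] (L' - 1) \<otimes> (x [^] j \<otimes> x [^] a))"
        unfolding t(4) b'(3) c(3) using closed by (simp add: m_ac)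
      also have "x [^] (L' - 1) \<otimes> (x [^] j \<otimes> x [^] a) = x [^] e \<otimes> x [^] i"
        using x by (simp only: nat_pow_mult e(1))
      also have "h' \<otimes> h2 = h' \<otimes> h2 \<otimes> (inv h \<otimes> h)" using closed by simp
      also have "\<dots> = (h' \<otimes> inv h \<otimes> h2) \<otimes> h"
        using closed by (simp only: m_ac m_closed inv_closed)
      also have "g \<otimes> ((h' \<otimes> inv h \<otimes> h2) \<otimes> h) \<otimes> (x [^] e \<otimes> x [^] i)
          = (g \<otimes> ((h' \<otimes> inv h \<otimes> h2) \<otimes> x [^] e)) \<otimes> b"
        unfolding b(3) using closed by (simp only: m_ac m_closed inv_closed nat_pow_closed)
      finally have "t \<otimes> c = g \<otimes> ((h' \<otimes> inv h \<otimes> h2) \<otimes> x [^] e)"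
        using closed b c by simp
      moreover have "h' \<otimes> inv h \<otimes> h2 \<in> H"
        using b(1) b'(1) c(1) H by (simp add: subgroup.m_closed subgroup.m_inv_closed)
      ultimately show ?thesis using e(2) progressionI by (fastforce simp: l_coset_def)
    qed
    then have "t <# progression G K y l \<subseteq> g <# progression G H x L" by (auto simp: l_coset_def)
    then show ?thesis using t(1) by blast
  qed
  then show ?thesis using K T(1) card_T by blast
qed

text \<open>
  The translating element is determined coarse to fine. If it is known up to a progression of size about
  \<open>s ^ (j + 1)\<close>, refine to a progression of size about \<open>s ^ j\<close> so that \<open>w j\<close> is moved
  into a prescribed translate \<open>t <# C\<close>, whatever the rest of the choice will be. The union of the prescribed
  translates has density at most \<open>8 / s\<close> and is added to the universal set; the remaining
  elements are dealt with inside the smaller progression.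
\<close>

lemma (in comm_group) ex_universal_in_progressions:
  fixes s :: real
  assumes fin: "finite (carrier G)" and s: "4 \<le> s" and B: "proper G H x L" "s ^ j < 2 * real (card H * L)"
  shows "\<exists>U \<subseteq> carrier G. real (card U) * s \<le> 8 * real j * real (order G) \<and>
    (\<forall>g\<in>carrier G. \<forall>w\<in>{..<j} \<rightarrow> carrier G.
      \<exists>c \<in> g <# progression G H x L. \<forall>i<j. c \<otimes> w i \<in> U)"
  using B
proof (induction j arbitrary: H x L)
  case 0
  then have H: "subgroup H G" "x \<in> carrier G" by (auto simp: proper_def)
  have "L > 0" using 0(2) by (intro Nat.gr0I) auto
  then have "\<one> \<otimes> x [^] (0::nat) \<in> progression G H x L"
    using H by (intro progressionI) (auto simp: subgroup.one_closed)
  then have "\<exists>c. c \<in> g <# progression G H x L" for g by (auto simp: l_coset_def)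
  then show ?case by (intro exI[of _ "{}"]) auto
next
  case (Suc j)
  define N where "N = order G"
  define m where "m = nat (floor (s ^ j))"
  have "s ^ j \<ge> 1" using s by simp
  then have m: "1 \<le> m" "real m \<le> s ^ j" "s ^ j < real m + 1"
    by (auto simp: m_def le_nat_floor)
  have "4 * s ^ j \<le> s ^ Suc j" using s \<open>s ^ j \<ge> 1\<close> by simp
  then have "2 * real m \<le> real (card H * L)" using m(2) Suc.prems(2) by linarith
  then have "2 * m \<le> card H * L" by (simp flip: of_nat_mult)
  from ex_refined_progression[OF fin Suc.prems(1) m(1) this]
  obtain K y l T where K: "proper G K y l" "card K * l \<le> m" "m < 2 * (card K * l)"
    and T: "T \<subseteq> carrier G" "card T * (card H * L) \<le> 4 * N"
    and refine: "\<And>g. g \<in> carrier G \<Longrightarrow> \<exists>t\<in>T. t <# progression G K y l \<subseteq> g <# progression G H x L"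
    unfolding N_def by blast
  let ?B = "progression G H x L" and ?C = "progression G K y l"
  have CG: "?C \<subseteq> carrier G" using progression_subset[OF K(1)] .
  have "s ^ j < 2 * real (card K * l)" using m K(3) by linarith
  then obtain U where U: "U \<subseteq> carrier G" "real (card U) * s \<le> 8 * real j * real N"
    and univ: "\<And>g w. g \<in> carrier G \<Longrightarrow> w \<in> {..<j} \<rightarrow> carrier G \<Longrightarrow>
      \<exists>c \<in> g <# ?C. \<forall>i<j. c \<otimes> w i \<in> U"
    using Suc.IH[OF K(1)] unfolding N_def by metis
  define U' where "U' = U \<union> (T <#> ?C)"
  have "U' \<subseteq> carrier G" using U(1) T(1) CG by (simp add: U'_def setmult_subset_G)
  moreover have "real (card U') * s \<le> 8 * real (Suc j) * real N"
  proof -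
    have "finite T" using T(1) fin finite_subset by blast
    have "finite ?C" using CG fin finite_subset by blast
    have "T <#> ?C = (\<lambda>(t, c). t \<otimes> c) ` (T \<times> ?C)" by (auto simp: set_mult_def)
    then have "card (T <#> ?C) \<le> card (T \<times> ?C)"
      using \<open>finite T\<close> \<open>finite ?C\<close> by (metis card_image_le finite_cartesian_product)
    also have "\<dots> \<le> card T * m"
      using K(2) by (simp add: card_cartesian_product card_progression[OF K(1)])
    finally have "real (card (T <#> ?C)) \<le> real (card T) * real m" by (metis of_nat_le_iff of_nat_mult)
    also have "\<dots> \<le> real (card T) * s ^ j" using m by (intro mult_left_mono) auto
    finally have "real (card (T <#> ?C)) * s \<le> real (card T) * s ^ j * s"
      using s by (intro mult_right_mono) auto
    also have "\<dots> = real (card T) * s ^ Suc j" by simp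
    also have "\<dots> \<le> real (card T) * (2 * real (card H * L))"
      using Suc.prems(2) by (intro mult_left_mono) auto
    also have "\<dots> = 2 * real (card T * (card H * L))" by simp
    also have "\<dots> \<le> 2 * real (4 * N)" using T(2) by (simp only: of_nat_le_iff mult_le_cancel_left_pos zero_less_numeral)
    finally have "real (card (T <#> ?C)) * s \<le> 8 * real N" by simp
    moreover have "real (card U') \<le> real (card U) + real (card (T <#> ?C))"
      unfolding U'_def using card_Un_le[of U "T <#> ?C"] by linarith
    then have "real (card U') * s \<le> (real (card U) + real (card (T <#> ?C))) * s"
      using s by (intro mult_right_mono) auto
    ultimately show ?thesis using U(2) by (simp add: algebra_simps)
  qed
  moreover have "\<exists>c \<in> g <# ?B. \<forall>i<Suc j. c \<otimes> w i \<in> U'"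
    if g: "g \<in> carrier G" and w: "w \<in> {..<Suc j} \<rightarrow> carrier G" for g w
  proof -
    have wj: "w j \<in> carrier G" using w by auto
    obtain t where t: "t \<in> T" "t <# ?C \<subseteq> (g \<otimes> w j) <# ?B" using refine[of "g \<otimes> w j"] g wj by auto
    have tG: "t \<in> carrier G" using t T by blast
    have "t \<otimes> inv (w j) \<in> carrier G" using tG wj by simp
    moreover have "w \<in> {..<j} \<rightarrow> carrier G" using w by auto
    ultimately obtain c where c: "c \<in> (t \<otimes> inv (w j)) <# ?C" "\<And>i. i < j \<Longrightarrow> c \<otimes> w i \<in> U"
      using univ by meson
    obtain b where b: "b \<in> ?C" "c = t \<otimes> inv (w j) \<otimes> b" using c(1) by (auto simp: l_coset_def)
    have bG: "b \<in> carrier G" using b CG by blast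
    have cw: "c \<otimes> w j = t \<otimes> b" unfolding b(2) using tG wj bG by (simp add: m_ac)
    obtain b2 where b2: "b2 \<in> ?B" "t \<otimes> b = g \<otimes> w j \<otimes> b2"
      using t(2) b(1) by (auto simp: l_coset_def)
    have b2G: "b2 \<in> carrier G" using b2(1) progression_subset[OF Suc.prems(1)] by blast
    have cG: "c \<in> carrier G" unfolding b(2) using tG wj bG by simp
    have "c \<otimes> w j = (g \<otimes> b2) \<otimes> w j" unfolding cw b2(2) using g wj b2G by (simp add: m_ac)
    then have "c = g \<otimes> b2" using cG g wj b2G by simp
    then have "c \<in> g <# ?B" using b2(1) by (auto simp: l_coset_def)
    moreover have "c \<otimes> w j \<in> U'" unfolding cw U'_def set_mult_def using t(1) b(1) by blast
    ultimately show ?thesis using c(2) by (auto simp: U'_def less_Suc_eq)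
  qed
  ultimately show ?case unfolding N_def by blast
qed

text \<open>
  Start the refinement from the whole group, with \<open>s\<close> the \<open>k\<close>-th root of its order. If
  this root is less than 4, the whole group is small enough.
\<close>

lemma comm_group_universal_set:
  fixes G :: "('a, 'm) monoid_scheme"
  assumes "comm_group G" and fin: "finite (carrier G)" and "k \<ge> 1"
  shows "\<exists>U. universal_set G k U \<and>
    real (card U) \<le> 8 * real k * real (order G) powr (1 - 1 / real k)"
proof -
  interpret comm_group G by fact
  define N where "N = order G"
  define s where "s = real N powr (1 / real k)"
  have "N > 0" unfolding N_def using fin order_gt_0_iff_finite by blast
  have target: "real (card U) \<le> 8 * real k * real N powr (1 - 1 / real k)"
    if "real (card U) * s \<le> 8 * real k * real N" for U :: "'a set"
    using that \<open>N > 0\<close> by (simp add: s_def powr_diff field_simps)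
  show ?thesis
  proof (cases "s \<ge> 4")
    case True
    have sk: "s ^ k = real N" using \<open>N > 0\<close> \<open>k \<ge> 1\<close> by (simp add: s_def powr_power)
    have "proper G (carrier G) \<one>\<^bsub>G\<^esub> 1" by (auto simp: proper_def inj_on_def subgroup_self)
    moreover have "s ^ k < 2 * real (card (carrier G) * 1)"
      using \<open>N > 0\<close> by (simp add: sk N_def Coset.order_def)
    ultimately obtain U where U: "U \<subseteq> carrier G" "real (card U) * s \<le> 8 * real k * real N"
      and univ: "\<And>g w. g \<in> carrier G \<Longrightarrow> w \<in> {..<k} \<rightarrow> carrier G \<Longrightarrow>
        \<exists>c \<in> g <#\<^bsub>G\<^esub> progression G (carrier G) \<one>\<^bsub>G\<^esub> 1. \<forall>i<k. c \<otimes>\<^bsub>G\<^esub> w i \<in> U"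
      using ex_universal_in_progressions[OF fin True] unfolding N_def by metis
    have "universal_set G k U"
      unfolding universal_set_def
    proof (intro conjI allI impI)
      fix W assume W: "W \<subseteq> carrier G \<and> finite W \<and> card W = k"
      then obtain w where w: "bij_betw w {0..<k} W" using ex_bij_betw_nat_finite by blast
      have "w \<in> {..<k} \<rightarrow> carrier G" using bij_betwE[OF w] W by auto
      then obtain c where c: "c \<in> \<one>\<^bsub>G\<^esub> <#\<^bsub>G\<^esub> progression G (carrier G) \<one>\<^bsub>G\<^esub> 1" "\<And>i. i < k \<Longrightarrow> c \<otimes>\<^bsub>G\<^esub> w i \<in> U"
        using univ[OF one_closed] by blast
      have "c \<in> carrier G"
        using c(1) \<open>proper G (carrier G) \<one>\<^bsub>G\<^esub> 1\<close> progression_subset l_coset_subset_G by blast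
      moreover have "c <#\<^bsub>G\<^esub> W \<subseteq> U"
        using c(2) bij_betw_imp_surj_on[OF w] by (auto simp: l_coset_def)
      ultimately show "\<exists>g\<in>carrier G. g <#\<^bsub>G\<^esub> W \<subseteq> U" by blast
    qed (fact U(1))
    then show ?thesis using target[OF U(2)] unfolding N_def by blast
  next
    case False
    have "real (card (carrier G)) * s \<le> real N * (8 * real k)"
      using False \<open>k \<ge> 1\<close> unfolding N_def Coset.order_def by (intro mult_left_mono) auto
    then have "real (card (carrier G)) \<le> 8 * real k * real N powr (1 - 1 / real k)"
      by (intro target) (simp add: mult.commute)
    moreover have "universal_set G k (carrier G)"
      unfolding universal_set_def
      by (intro conjI allI impI bexI[of _ "\<one>\<^bsub>G\<^esub>"]) (auto simp: l_coset_def)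
    ultimately show ?thesis unfolding N_def by blast
  qed
qed

section \<open>Universal sets in the three families of groups\<close>

theorem theorem1p3:
  fixes k :: nat
  assumes "k \<ge> 2"
  shows "(\<forall>G :: ('a, 'm) monoid_scheme. group G \<and> finite (carrier G) \<and> cyclic_group G \<longrightarrow>
           (\<exists>U. universal_set G k U \<and>
                real (card U) \<le> 72 * real (order G) powr (1 - 1 / real k))) \<and>
         (\<forall>n :: nat. n \<ge> 1 \<longrightarrow>
           (\<exists>U. universal_set (sym_group n) k U \<and>
                real (card U) \<le> fact (3 * k + 1) * real (order (sym_group n)) powr (1 - 1 / real k))) \<and>
         (\<forall>G :: ('b, 'n) monoid_scheme. comm_group G \<and> finite (carrier G) \<longrightarrow>
           (\<exists>U. universal_set G k U \<and>
                real (card U) \<le> 8 ^ (k - 1) * real k * real (order G) powr (1 - 1 / real k)))"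
proof (intro conjI allI impI)
  fix G :: "('a, 'm) monoid_scheme"
  assume G: "group G \<and> finite (carrier G) \<and> cyclic_group G"
  then obtain U where U: "universal_set G k U"
    "real (card U) \<le> 10 * real (order G) powr (1 - 1 / real k)"
    using cyclic_universal_set[of G k] assms by auto
  have "10 * real (order G) powr (1 - 1 / real k) \<le> 72 * real (order G) powr (1 - 1 / real k)"
    by (intro mult_right_mono) auto
  then show "\<exists>U. universal_set G k U \<and> real (card U) \<le> 72 * real (order G) powr (1 - 1 / real k)"
    using U by (intro exI[of _ U]) linarith
next
  fix n :: nat
  show "\<exists>U. universal_set (sym_group n) k U \<and>
      real (card U) \<le> fact (3 * k + 1) * real (order (sym_group n)) powr (1 - 1 / real k)"
    using sym_group_universal_set[of k n] assms by simp
next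
  fix G :: "('b, 'n) monoid_scheme"
  assume G: "comm_group G \<and> finite (carrier G)"
  then obtain U where U: "universal_set G k U"
    "real (card U) \<le> 8 * real k * real (order G) powr (1 - 1 / real k)"
    using comm_group_universal_set[of G k] assms by auto
  have "(8::real) ^ 1 \<le> 8 ^ (k - 1)" using assms by (intro power_increasing) auto
  then have "8 * real k * real (order G) powr (1 - 1 / real k)
      \<le> 8 ^ (k - 1) * real k * real (order G) powr (1 - 1 / real k)"
    by (intro mult_right_mono) auto
  then show "\<exists>U. universal_set G k U \<and>
      real (card U) \<le> 8 ^ (k - 1) * real k * real (order G) powr (1 - 1 / real k)"
    using U by (intro exI[of _ U]) linarith
qed

end
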